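(* Let $F:[0,1]\to\mathbb{R}$ be a differentiable function whose derivative $F'$ is not constant. Then the union of all tangent lines of $F$, i.e. the set $\bigcup_{x_0\in[0,1]}\{(x,y)\in\mathbb{R}^2 : y=F'(x_0)(x-x_0)+F(x_0)\}$, has Hausdorff dimension $2$.
   Context: Differentiability at the endpoints $0$ and $1$ is understood in the one-sided sense (with finite derivative). *)

theory Defs
  imports "HOL-Analysis.Analysis"
begin

text \<open>
  The contribution of one covering set to the \<open>s\<close>-dimensional Hausdorff sum, \<open>(diam U)\<^sup>s\<close>, with the
  usual conventions \<open>0\<^sup>0 = 1\<close> for nonempty \<open>U\<close> (whereas \<open>0 powr 0 = 0\<close> in the library) and
  contribution \<open>0\<close> of the empty set for every \<open>s\<close>.
\<close>

definition hausdorff_weight :: "real \<Rightarrow> 'a::metric_space set \<Rightarrow> ennreal" where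
  "hausdorff_weight s U =
     (if U = {} then 0 else if s = 0 then 1 else ennreal (diameter U powr s))"

text \<open>
  Boundedness of the covering sets is explicit because \<open>diameter\<close> is a real number and carries no
  information for unbounded sets. Finite covers are included, as the \<open>U i\<close> may be empty.
\<close>

definition hausdorff_premeasure :: "real \<Rightarrow> real \<Rightarrow> 'a::metric_space set \<Rightarrow> ennreal" where
  "hausdorff_premeasure s \<delta> A =
     Inf {(\<Sum>i. hausdorff_weight s (U i)) | U :: nat \<Rightarrow> 'a set.
            A \<subseteq> (\<Union>i. U i) \<and> (\<forall>i. bounded (U i) \<and> diameter (U i) \<le> \<delta>)}"

definition hausdorff_measure :: "real \<Rightarrow> 'a::metric_space set \<Rightarrow> ennreal" where
  "hausdorff_measure s A = (SUP \<delta>\<in>{0<..}. hausdorff_premeasure s \<delta> A)"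

definition hausdorff_dim :: "'a::metric_space set \<Rightarrow> ennreal" where
  "hausdorff_dim A = Inf {ennreal s | s. 0 \<le> s \<and> hausdorff_measure s A = 0}"

text \<open>
  The plane is \<^typ>\<open>real \<times> real\<close>, whose library metric is the Euclidean one.
  \<open>F'\<close> is the derivative of \<open>F\<close>.
\<close>

definition tangent_line :: "(real \<Rightarrow> real) \<Rightarrow> (real \<Rightarrow> real) \<Rightarrow> real \<Rightarrow> (real \<times> real) set" where
  "tangent_line F F' x0 = {(x, y). y = F' x0 * (x - x0) + F x0}"

end

theory Submission
  imports Defs
begin

text \<open>
  Let \<open>A\<close> be the union of the tangents. Over a fixed abscissa \<open>X\<close> the tangent at \<open>x\<close> has height
  \<open>F' x * (X - x) + F x\<close>. As a function of \<open>x\<close> this need not be continuous, but it is itself a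
  derivative, namely that of \<open>F x * (X - x) + 2 * \<integral>F\<close>, so by Darboux's theorem it takes every value
  between any two of its values. Hence each vertical section of \<open>A\<close> is an interval, and \<open>A\<close>
  contains everything that lies vertically between two of the tangents
  (\<open>between_tangents_subset\<close>). As \<open>F'\<close> is not constant, there are two tangents of different slope,
  and between them there is an open double wedge: \<open>A\<close> has nonempty interior
  (\<open>tangents_contain_open\<close>).

  It remains to know that a set with nonempty interior in an \<open>n\<close>-dimensional space has dimension at
  least \<open>n\<close> (\<open>hausdorff_dim_ge_if_open_subset\<close>: a set of diameter \<open>d\<close> has outer Lebesgue measure at
  most \<open>(2d)\<^sup>n\<close>, so Lebesgue measure is bounded by a multiple of the Hausdorff sums of exponent at
  most \<open>n\<close>), and that no subset of the plane has dimension above 2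
  (\<open>hausdorff_dim_plane_le\<close>: \<open>N\<^sup>2\<close> tiles of diameter of order \<open>1/N\<close> cover a square, and
  \<open>N\<^sup>2 * N powr (-s)\<close> tends to 0 for \<open>s > 2\<close>).
\<close>

section \<open>Intermediate values of derivatives\<close>

text \<open>
  Darboux's theorem: \<open>G x - t * x\<close> decreases at \<open>a\<close> and increases at \<open>b\<close>, so that its minimum lies in
  the interior, and there its derivative \<open>g x - t\<close> vanishes.
\<close>

lemma derivative_darboux:
  fixes G g :: "real \<Rightarrow> real"
  assumes G: "\<And>x. x \<in> {a..b} \<Longrightarrow> (G has_real_derivative g x) (at x within {a..b})"
    and "a < b" "g a < t" "t < g b"
  shows "\<exists>x\<in>{a..b}. g x = t"
proof -
  define H where "H x = G x - t * x" for x
  have H: "(H has_real_derivative g x - t) (at x within {a..b})" if "x \<in> {a..b}" for x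
    unfolding H_def by (auto intro!: derivative_eq_intros G that)
  have "continuous_on {a..b} H"
    using H by (meson DERIV_continuous_on)
  then obtain c where c: "c \<in> {a..b}" and min: "\<And>y. y \<in> {a..b} \<Longrightarrow> H c \<le> H y"
    using continuous_attains_inf[of "{a..b}" H] \<open>a < b\<close> by auto
  have "c \<noteq> a"
  proof
    assume "c = a"
    obtain d where "d > 0" and d: "\<And>h. \<lbrakk>h > 0; a + h \<in> {a..b}; h < d\<rbrakk> \<Longrightarrow> H (a + h) < H a"
      using has_real_derivative_neg_dec_right[OF H[of a]] assms by auto
    have "H (a + min (d/2) (b - a)) < H a"
      using \<open>d > 0\<close> \<open>a < b\<close> by (intro d) (auto simp: min_def)
    moreover have "H c \<le> H (a + min (d/2) (b - a))"
      using \<open>d > 0\<close> \<open>a < b\<close> by (intro min) (auto simp: min_def)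
    ultimately show False
      using \<open>c = a\<close> by simp
  qed
  moreover have "c \<noteq> b"
  proof
    assume "c = b"
    obtain d where "d > 0" and d: "\<And>h. \<lbrakk>h > 0; b - h \<in> {a..b}; h < d\<rbrakk> \<Longrightarrow> H (b - h) < H b"
      using has_real_derivative_pos_inc_left[OF H[of b]] assms by auto
    have "H (b - min (d/2) (b - a)) < H b"
      using \<open>d > 0\<close> \<open>a < b\<close> by (intro d) (auto simp: min_def)
    moreover have "H c \<le> H (b - min (d/2) (b - a))"
      using \<open>d > 0\<close> \<open>a < b\<close> by (intro min) (auto simp: min_def)
    ultimately show False
      using \<open>c = b\<close> by simp
  qed
  ultimately have "a < c" "c < b"
    using c by auto
  then have "(H has_real_derivative g c - t) (at c)"
    using H[OF c] by (simp add: at_within_Icc_at)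
  then have "g c - t = 0"
    by (rule DERIV_local_min[where d = "min (c - a) (b - c)"])
       (use \<open>a < c\<close> \<open>c < b\<close> in \<open>auto intro!: min\<close>)
  then show ?thesis
    using c by auto
qed

lemma derivative_intermediate_value:
  fixes G g :: "real \<Rightarrow> real"
  assumes G: "\<And>x. x \<in> {a..b} \<Longrightarrow> (G has_real_derivative g x) (at x within {a..b})"
    and u: "u \<in> {a..b}" and v: "v \<in> {a..b}" and t: "g u < t" "t < g v"
  shows "\<exists>x\<in>{a..b}. g x = t"
proof (cases u v rule: linorder_cases)
  case less
  have "\<exists>x\<in>{u..v}. g x = t"
    using less t u v by (intro derivative_darboux[of u v G]) (auto intro: DERIV_subset[OF G])
  then show ?thesis
    using u v by force
next
  case equal
  then show ?thesis
    using t by simp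
next
  case greater
  have "\<exists>x\<in>{v..u}. - g x = - t"
    using greater t u v
    by (intro derivative_darboux[of v u "\<lambda>x. - G x"])
       (auto intro!: DERIV_minus intro: DERIV_subset[OF G])
  then show ?thesis
    using u v by force
qed

section \<open>The region between two tangents\<close>

text \<open>
  Writing the height over \<open>X\<close> as a derivative: the product rule gives
  \<open>(F x * (X - x))' = F' x * (X - x) - F x\<close>, which has the wrong sign on \<open>F x\<close>; twice an
  antiderivative of the continuous function \<open>F\<close> corrects it.
\<close>

lemma between_tangents_subset:
  fixes F F' :: "real \<Rightarrow> real"
  assumes F: "\<And>x. x \<in> {a..b} \<Longrightarrow> (F has_real_derivative F' x) (at x within {a..b})"
    and u: "u \<in> {a..b}" and v: "v \<in> {a..b}"
    and y: "F' u * (X - u) + F u < y" "y < F' v * (X - v) + F v"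
  shows "(X, y) \<in> (\<Union>x0\<in>{a..b}. tangent_line F F' x0)"
proof -
  have "continuous_on {a..b} F"
    using F by (meson DERIV_continuous_on)
  then have I: "((\<lambda>x. integral {a..x} F) has_real_derivative F x) (at x within {a..b})"
    if "x \<in> {a..b}" for x
    using that by (rule integral_has_real_derivative)
  have "((\<lambda>x. F x * (X - x) + 2 * integral {a..x} F) has_real_derivative F' x * (X - x) + F x)
      (at x within {a..b})" if "x \<in> {a..b}" for x
    by (rule derivative_eq_intros F I that refl | simp)+
  from derivative_intermediate_value[OF this u v y]
  show ?thesis
    by (auto simp: tangent_line_def)
qed

lemma tangents_contain_open:
  fixes F F' :: "real \<Rightarrow> real"
  assumes F: "\<And>x. x \<in> {a..b} \<Longrightarrow> (F has_real_derivative F' x) (at x within {a..b})"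
    and "\<not> F' constant_on {a..b}"
  shows "\<exists>W. open W \<and> W \<noteq> {} \<and> W \<subseteq> (\<Union>x0\<in>{a..b}. tangent_line F F' x0)"
proof -
  obtain u v where u: "u \<in> {a..b}" and v: "v \<in> {a..b}" and ne: "F' u \<noteq> F' v"
    using assms(2) unfolding constant_on_def by metis
  define p where "p X = F' u * (X - u) + F u" for X
  define q where "q X = F' v * (X - v) + F v" for X
  define W where "W = {z. p (fst z) < snd z \<and> snd z < q (fst z)}"
  \<comment> \<open>The abscissa at which the first tangent runs exactly two units below the second.\<close>
  define X where "X = (F' u * u - F u - F' v * v + F v - 2) / (F' u - F' v)"
  have "(F' u - F' v) * X = F' u * u - F u - F' v * v + F v - 2"
    using ne by (simp add: X_def)
  then have "q X = p X + 2"
    unfolding p_def q_def by (simp add: algebra_simps)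
  then have "(X, p X + 1) \<in> W"
    by (simp add: W_def)
  moreover have "open W"
    unfolding W_def p_def q_def by (intro open_Collect_conj open_Collect_less continuous_intros)
  moreover have "W \<subseteq> (\<Union>x0\<in>{a..b}. tangent_line F F' x0)"
    using between_tangents_subset[OF F u v] unfolding W_def p_def q_def by force
  ultimately show ?thesis
    by blast
qed

section \<open>Hausdorff dimension and Lebesgue measure\<close>

text \<open>
  The box is the cube of side twice the diameter around any point of \<open>U\<close>.
\<close>

lemma bounded_subset_box_diameter:
  fixes U :: "'a::euclidean_space set"
  assumes "bounded U"
  obtains B where "U \<subseteq> B" "B \<in> sets borel"
    "emeasure lborel B \<le> ennreal (2 ^ DIM('a) * diameter U ^ DIM('a))"
proof (cases "U = {}")
  case True
  then show ?thesis
    by (intro that[of "{}"]) auto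
next
  case False
  then obtain x where "x \<in> U"
    by blast
  define d where "d = diameter U"
  have "d \<ge> 0"
    unfolding d_def by (rule diameter_ge_0[OF assms])
  define B where "B = cbox (x - d *\<^sub>R One) (x + d *\<^sub>R One)"
  have "U \<subseteq> B"
  proof
    fix y assume "y \<in> U"
    then have "norm (y - x) \<le> d"
      using diameter_bounded_bound[OF assms \<open>y \<in> U\<close> \<open>x \<in> U\<close>] by (simp add: d_def dist_norm)
    then have "\<bar>(y - x) \<bullet> i\<bar> \<le> d" if "i \<in> Basis" for i
      using Basis_le_norm[OF that, of "y - x"] by linarith
    then show "y \<in> B"
      unfolding B_def mem_box by (auto simp: inner_simps abs_le_iff algebra_simps)
  qed
  moreover have "emeasure lborel B = ennreal (\<Prod>i\<in>(Basis::'a set). 2 * d)"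
    using \<open>d \<ge> 0\<close> unfolding B_def
    by (subst emeasure_lborel_cbox) (auto simp: inner_simps)
  ultimately show ?thesis
    by (intro that[of B]) (auto simp: B_def d_def power_mult_distrib)
qed

text \<open>
  Covers by sets of diameter at most 1 suffice here: for such diameters \<open>d\<close> and \<open>s \<le> n\<close> one has
  \<open>d\<^sup>n \<le> d\<^sup>s\<close>, so each weight dominates the measure of an enclosing box up to the factor \<open>2\<^sup>n\<close>.
\<close>

lemma lborel_le_hausdorff_premeasure:
  fixes W :: "'a::euclidean_space set"
  assumes "W \<in> sets borel" and s: "0 \<le> s" "s \<le> real DIM('a)"
  shows "emeasure lborel W \<le> 2 ^ DIM('a) * hausdorff_premeasure s 1 W"
proof -
  have "emeasure lborel W / 2 ^ DIM('a) \<le> (\<Sum>i. hausdorff_weight s (U i))"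
    if cover: "W \<subseteq> (\<Union>i. U i)" and U: "\<And>i. bounded (U i)" "\<And>i. diameter (U i) \<le> 1"
    for U :: "nat \<Rightarrow> 'a set"
  proof -
    have "\<exists>B. U i \<subseteq> B \<and> B \<in> sets borel \<and>
        emeasure lborel B \<le> 2 ^ DIM('a) * hausdorff_weight s (U i)" for i
    proof -
      obtain B where B: "U i \<subseteq> B" "B \<in> sets borel"
        "emeasure lborel B \<le> ennreal (2 ^ DIM('a) * diameter (U i) ^ DIM('a))"
        using bounded_subset_box_diameter[OF U(1)] by metis
      have d: "0 \<le> diameter (U i)"
        by (rule diameter_ge_0[OF U(1)])
      have "diameter (U i) ^ DIM('a) \<le> diameter (U i) powr s"
        using powr_mono'[OF s(2) d U(2)] d by (cases "diameter (U i) = 0") (auto simp: powr_realpow zero_power)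
      moreover have "diameter (U i) ^ DIM('a) \<le> 1"
        using d U(2) by (simp add: power_le_one)
      ultimately have "ennreal (diameter (U i) ^ DIM('a)) \<le> hausdorff_weight s (U i)"
        if "U i \<noteq> {}"
        using that by (auto simp: hausdorff_weight_def intro: ennreal_leI)
      then have "emeasure lborel B \<le> 2 ^ DIM('a) * hausdorff_weight s (U i)"
        using B(3) d
        by (cases "U i = {}")
           (auto simp: zero_power ennreal_mult ennreal_power[symmetric] intro: order_trans[OF _ mult_left_mono])
      then show ?thesis
        using B by blast
    qed
    then obtain B where B: "\<And>i. U i \<subseteq> B i" "\<And>i. B i \<in> sets borel"
      "\<And>i. emeasure lborel (B i) \<le> 2 ^ DIM('a) * hausdorff_weight s (U i)"
      by metis
    have "emeasure lborel W \<le> emeasure lborel (\<Union>i. B i)"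
      using cover B(1,2) by (intro emeasure_mono) force+
    also have "\<dots> \<le> (\<Sum>i. emeasure lborel (B i))"
      using B(2) by (intro emeasure_subadditive_countably) auto
    also have "\<dots> \<le> (\<Sum>i. 2 ^ DIM('a) * hausdorff_weight s (U i))"
      using B(3) by (intro suminf_le) auto
    also have "\<dots> = 2 ^ DIM('a) * (\<Sum>i. hausdorff_weight s (U i))"
      by simp
    finally show ?thesis
      by (intro divide_le_posI_ennreal) (auto simp: mult.commute zero_less_iff_neq_zero)
  qed
  then have "emeasure lborel W / 2 ^ DIM('a) \<le> hausdorff_premeasure s 1 W"
    unfolding hausdorff_premeasure_def by (intro Inf_greatest) auto
  then have "2 ^ DIM('a) * (emeasure lborel W / 2 ^ DIM('a)) \<le> 2 ^ DIM('a) * hausdorff_premeasure s 1 W"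
    by (rule mult_left_mono) simp
  moreover have "2 ^ DIM('a) * (emeasure lborel W / 2 ^ DIM('a)) = emeasure lborel W"
    using ennreal_mult_divide_eq[of "2 ^ DIM('a)" "emeasure lborel W"]
    by (simp add: ennreal_times_divide mult.commute power_eq_top_ennreal)
  ultimately show ?thesis
    by simp
qed

lemma hausdorff_premeasure_mono:
  "A \<subseteq> B \<Longrightarrow> hausdorff_premeasure s \<delta> A \<le> hausdorff_premeasure s \<delta> B"
  unfolding hausdorff_premeasure_def by (intro Inf_superset_mono) blast

lemma hausdorff_dim_ge_if_open_subset:
  fixes A W :: "'a::euclidean_space set"
  assumes "open W" "W \<noteq> {}" "W \<subseteq> A"
  shows "ennreal (real DIM('a)) \<le> hausdorff_dim A"
  unfolding hausdorff_dim_def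
proof (safe intro!: Inf_greatest)
  fix s :: real
  assume "0 \<le> s" and null: "hausdorff_measure s A = 0"
  have W: "emeasure lborel W \<noteq> 0" "W \<in> sets borel"
    using open_not_negligible[OF assms(1,2)] \<open>open W\<close>
    by (auto simp: negligible_iff_null_sets null_sets_def)
  have "hausdorff_premeasure s 1 W \<le> hausdorff_premeasure s 1 A"
    using assms(3) by (rule hausdorff_premeasure_mono)
  also have "\<dots> \<le> hausdorff_measure s A"
    unfolding hausdorff_measure_def by (intro SUP_upper) auto
  finally have "hausdorff_premeasure s 1 W = 0"
    using null by simp
  then have "\<not> s \<le> real DIM('a)"
    using lborel_le_hausdorff_premeasure[OF W(2) \<open>0 \<le> s\<close>] W(1) by auto
  then show "ennreal (real DIM('a)) \<le> ennreal s"
    by (intro ennreal_leI) auto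
qed

section \<open>Plane sets have dimension at most two\<close>

text \<open>
  The tiles have side \<open>h = 2 * r / N\<close>; bounding the Euclidean norm by the sum of the coordinates
  gives the diameter bound \<open>2 * h\<close>. The index \<open>j < N\<^sup>2\<close> encodes column and row as quotient and
  remainder modulo \<open>N\<close>.
\<close>

lemma square_tiling:
  fixes r :: real and N :: nat
  assumes "0 < r" "0 < N"
  obtains U :: "nat \<Rightarrow> (real \<times> real) set"
  where "{-r..<r} \<times> {-r..<r} \<subseteq> (\<Union>j. U j)" "\<And>j. N\<^sup>2 \<le> j \<Longrightarrow> U j = {}"
    "\<And>j. bounded (U j)" "\<And>j. diameter (U j) \<le> 4 * r / real N"
proof -
  define h where "h = 2 * r / real N"
  have h: "h > 0" "h * real N = 2 * r"
    using assms by (auto simp: h_def)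
  define J where "J k = {-r + real k * h .. -r + real k * h + h}" for k
  define U where "U j = (if j < N\<^sup>2 then J (j div N) \<times> J (j mod N) else {})" for j
  have J: "\<exists>k<N. x \<in> J k" if "x \<in> {-r..<r}" for x
  proof -
    define k where "k = nat \<lfloor>(x + r) / h\<rfloor>"
    have "0 \<le> (x + r) / h"
      using that h by auto
    then have k: "real k \<le> (x + r) / h" "(x + r) / h < real k + 1"
      unfolding k_def by linarith+
    have "(x + r) / h < real N"
      using that h by (simp add: field_simps)
    with k(1) have "k < N"
      by linarith
    moreover have "x \<in> J k"
      using k h unfolding J_def by (auto simp: field_simps)
    ultimately show ?thesis
      by blast
  qed
  show ?thesis
  proof
    show "{-r..<r} \<times> {-r..<r} \<subseteq> (\<Union>j. U j)"
    proof clarify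
      fix x y assume "x \<in> {-r..<r}" "y \<in> {-r..<r}"
      then obtain k l where kl: "k < N" "x \<in> J k" "l < N" "y \<in> J l"
        using J by blast
      have "(k + 1) * N \<le> N * N"
        using kl by (intro mult_right_mono) auto
      then have "k * N + l < N\<^sup>2"
        using kl by (simp add: power2_eq_square)
      then have "(x, y) \<in> U (k * N + l)"
        using kl by (simp add: U_def)
      then show "(x, y) \<in> (\<Union>j. U j)"
        by blast
    qed
    show "U j = {}" if "N\<^sup>2 \<le> j" for j
      using that by (simp add: U_def)
    show "bounded (U j)" for j
      by (auto simp: U_def J_def intro!: bounded_Times)
    show "diameter (U j) \<le> 4 * r / real N" for j
    proof (rule diameter_le)
      show "U j \<noteq> {} \<or> 0 \<le> 4 * r / real N"
        using assms by auto
      fix z w assume "z \<in> U j" "w \<in> U j"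
      then have "\<bar>fst (z - w)\<bar> \<le> h" "\<bar>snd (z - w)\<bar> \<le> h"
        by (auto simp: U_def J_def abs_le_iff split: if_splits)
      moreover have "norm (z - w) \<le> \<bar>fst (z - w)\<bar> + \<bar>snd (z - w)\<bar>"
        using norm_Pair_le[of "fst (z - w)" "snd (z - w)"] unfolding prod.collapse by simp
      moreover have "4 * r / real N = 2 * h"
        by (simp add: h_def)
      ultimately show "norm (z - w) \<le> 4 * r / real N"
        by linarith
    qed
  qed
qed

text \<open>
  The tiling into \<open>N\<^sup>2\<close> pieces has Hausdorff sum at most
  \<open>N\<^sup>2 * (4 * r / N) powr s = (4 * r) powr s * N powr (2 - s)\<close>, which is small for large \<open>N\<close>.
\<close>

lemma square_cover_small_sum:
  fixes r s \<delta> \<epsilon> :: real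
  assumes "0 < r" "2 < s" "0 < \<delta>" "0 < \<epsilon>"
  obtains U :: "nat \<Rightarrow> (real \<times> real) set"
  where "{-r..<r} \<times> {-r..<r} \<subseteq> (\<Union>j. U j)" "\<And>j. bounded (U j)" "\<And>j. diameter (U j) \<le> \<delta>"
    "(\<Sum>j. hausdorff_weight s (U j)) \<le> ennreal \<epsilon>"
proof -
  have lim1: "(\<lambda>N. 4 * r / real N) \<longlonglongrightarrow> 0"
    by (rule lim_const_over_n)
  have "(\<lambda>N. real N powr (2 - s)) \<longlonglongrightarrow> 0"
    using assms by (intro tendsto_neg_powr filterlim_real_sequentially) auto
  then have lim2: "(\<lambda>N. (4 * r) powr s * real N powr (2 - s)) \<longlonglongrightarrow> 0"
    by (rule tendsto_mult_right_zero)
  have "\<forall>\<^sub>F N in sequentially. 4 * r / real N < \<delta> \<and>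
      (4 * r) powr s * real N powr (2 - s) < \<epsilon> \<and> 0 < N"
    using order_tendstoD(2)[OF lim1 \<open>0 < \<delta>\<close>] order_tendstoD(2)[OF lim2 \<open>0 < \<epsilon>\<close>]
      eventually_gt_at_top[of "0::nat"]
    by eventually_elim auto
  then obtain N :: nat where N: "4 * r / real N < \<delta>"
      "(4 * r) powr s * real N powr (2 - s) < \<epsilon>" "0 < N"
    by (auto simp: eventually_sequentially)
  obtain U :: "nat \<Rightarrow> (real \<times> real) set"
    where U: "{-r..<r} \<times> {-r..<r} \<subseteq> (\<Union>j. U j)" "\<And>j. N\<^sup>2 \<le> j \<Longrightarrow> U j = {}"
      "\<And>j. bounded (U j)" "\<And>j. diameter (U j) \<le> 4 * r / real N"
    using square_tiling[OF \<open>0 < r\<close> N(3)] by blast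
  have "(\<Sum>j. hausdorff_weight s (U j)) = (\<Sum>j<N\<^sup>2. hausdorff_weight s (U j))"
    using U(2) by (intro suminf_finite) (auto simp: hausdorff_weight_def)
  also have "\<dots> \<le> (\<Sum>j<N\<^sup>2. ennreal ((4 * r / real N) powr s))"
    using U(4) diameter_ge_0[OF U(3)] assms
    by (intro sum_mono) (auto simp: hausdorff_weight_def intro!: ennreal_leI powr_mono2)
  also have "\<dots> = ennreal (real (N\<^sup>2) * (4 * r / real N) powr s)"
    by (simp add: ennreal_mult ennreal_of_nat_eq_real_of_nat)
  also have "real (N\<^sup>2) * (4 * r / real N) powr s = (4 * r) powr s * real N powr (2 - s)"
    using assms N(3) by (simp add: powr_divide powr_diff)
  also have "ennreal \<dots> \<le> ennreal \<epsilon>"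
    using N(2) by (intro ennreal_leI) simp
  finally have "(\<Sum>j. hausdorff_weight s (U j)) \<le> ennreal \<epsilon>" .
  moreover have "diameter (U j) \<le> \<delta>" for j
    using U(4)[of j] N(1) by linarith
  ultimately show ?thesis
    using that U by blast
qed

text \<open>
  The plane is the union of the squares of half-side \<open>1, 2, 3, \<dots>\<close>. Covering the \<open>i\<close>-th one, counted
  from 0, with Hausdorff sum at most \<open>\<epsilon> / 2 ^ (i + 1)\<close> and merging the covers into a single sequence
  gives a cover of the plane with sum at most \<open>\<epsilon>\<close>.
\<close>

lemma hausdorff_premeasure_plane_eq_0:
  fixes A :: "(real \<times> real) set"
  assumes "2 < s" "0 < \<delta>"
  shows "hausdorff_premeasure s \<delta> A = 0"
proof -
  have "hausdorff_premeasure s \<delta> A \<le> 0 + ennreal \<epsilon>" if "0 < \<epsilon>" for \<epsilon>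
  proof -
    have "\<exists>U. {-real (Suc i)..<real (Suc i)} \<times> {-real (Suc i)..<real (Suc i)} \<subseteq> (\<Union>j. U j) \<and>
        (\<forall>j. bounded (U j) \<and> diameter (U j) \<le> \<delta>) \<and>
        (\<Sum>j. hausdorff_weight s (U j)) \<le> ennreal (\<epsilon> * (1/2) ^ Suc i)" for i :: nat
      using square_cover_small_sum[of "real (Suc i)" s \<delta> "\<epsilon> * (1/2) ^ Suc i"] assms that
      by (metis mult_pos_pos of_nat_0_less_iff zero_less_Suc zero_less_power half_gt_zero zero_less_one)
    then obtain U where
      U: "\<And>i. {-real (Suc i)..<real (Suc i)} \<times> {-real (Suc i)..<real (Suc i)} \<subseteq> (\<Union>j. U i j)"
        "\<And>i j. bounded (U i j)" "\<And>i j. diameter (U i j) \<le> \<delta>"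
        "\<And>i. (\<Sum>j. hausdorff_weight s (U i j)) \<le> ennreal (\<epsilon> * (1/2) ^ Suc i)"
      by metis
    define V where "V n = case_prod U (prod_decode n)" for n
    have "A \<subseteq> (\<Union>n. V n)"
    proof clarify
      fix x y :: real
      obtain i :: nat where "max \<bar>x\<bar> \<bar>y\<bar> < real i"
        using reals_Archimedean2 by blast
      then have "(x, y) \<in> {-real (Suc i)..<real (Suc i)} \<times> {-real (Suc i)..<real (Suc i)}"
        by auto
      then obtain j where "(x, y) \<in> U i j"
        using U(1)[of i] by blast
      then have "(x, y) \<in> V (prod_encode (i, j))"
        by (simp add: V_def)
      then show "(x, y) \<in> (\<Union>n. V n)"
        by blast
    qed
    moreover have "bounded (V n) \<and> diameter (V n) \<le> \<delta>" for n
      using U(2,3) by (auto simp: V_def split: prod.split)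
    ultimately have "hausdorff_premeasure s \<delta> A \<le> (\<Sum>n. hausdorff_weight s (V n))"
      unfolding hausdorff_premeasure_def by (intro Inf_lower) blast
    also have "\<dots> = (\<Sum>n. (\<lambda>(i, j). hausdorff_weight s (U i j)) (prod_decode n))"
      by (simp add: V_def case_prod_beta)
    also have "\<dots> = (\<Sum>i. \<Sum>j. hausdorff_weight s (U i j))"
      by (rule suminf_ennreal_2dimen) simp
    also have "\<dots> \<le> (\<Sum>i. ennreal (\<epsilon> * (1/2) ^ Suc i))"
      using U(4) by (intro suminf_le) auto
    also have "\<dots> = ennreal \<epsilon>"
      using sums_mult[OF power_half_series, of \<epsilon>] that by (intro suminf_ennreal_eq) auto
    finally show ?thesis
      by simp
  qed
  then have "hausdorff_premeasure s \<delta> A \<le> 0"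
    by (rule ennreal_le_epsilon)
  then show ?thesis
    by simp
qed

lemma hausdorff_dim_plane_le:
  fixes A :: "(real \<times> real) set"
  shows "hausdorff_dim A \<le> 2"
proof -
  have "hausdorff_dim A \<le> 2 + ennreal \<epsilon>" if "0 < \<epsilon>" for \<epsilon>
  proof -
    have "hausdorff_measure (2 + \<epsilon>) A = 0"
      using that unfolding hausdorff_measure_def
      by (simp add: hausdorff_premeasure_plane_eq_0)
    then have "hausdorff_dim A \<le> ennreal (2 + \<epsilon>)"
      unfolding hausdorff_dim_def using that by (intro Inf_lower CollectI exI[of _ "2 + \<epsilon>"]) auto
    then show ?thesis
      using that by simp
  qed
  then show ?thesis
    by (rule ennreal_le_epsilon)
qed

section \<open>The union of the tangents\<close>

theorem theorem2p4:
  fixes F F' :: "real \<Rightarrow> real"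
  assumes "\<And>x. x \<in> {0..1} \<Longrightarrow> (F has_real_derivative F' x) (at x within {0..1})"
    and "\<not> F' constant_on {0..1}"
  shows "hausdorff_dim (\<Union>x0\<in>{0..1}. tangent_line F F' x0) = 2"
proof (rule antisym)
  obtain W where "open W" "W \<noteq> {}" "W \<subseteq> (\<Union>x0\<in>{0..1}. tangent_line F F' x0)"
    using tangents_contain_open[OF assms] by blast
  from hausdorff_dim_ge_if_open_subset[OF this]
  show "2 \<le> hausdorff_dim (\<Union>x0\<in>{0..1}. tangent_line F F' x0)"
    by simp
qed (rule hausdorff_dim_plane_le)

end
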